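(* Let $m<n$ and $k<m$ be positive integers, let $X\in\mathbb{R}^{m\times n}$ with singular values $\sigma_1\ge\dots\ge\sigma_m\ge0$, and let $J(W,S)=\tfrac12\|X-WS\|_F^2$ on $\mathbb{R}^{m\times k}\times\mathbb{R}^{k\times n}$. Let $(W_c,S_c)$ be any canonical point with $\mathrm{rank}(W_c)=k$ that is a strict saddle of $J$. Then there is no $\gamma<0$ such that $\lambda_{\min}(\nabla^2J(W,S))\le\gamma$ for all $(W,S)\in\Theta(W_c,S_c)$.
   Context: $\mathbb{R}^{m\times k}\times\mathbb{R}^{k\times n}$ carries the inner product $\langle (G,H),(G',H')\rangle=\mathrm{trace}(G^TG')+\mathrm{trace}(H^TH')$. With $E=WS-X$, $\nabla J(W,S)=(ES^T,W^TE)$ and the Hessian map is the self-adjoint linear map $\nabla^2J(W,S)[(G,H)]=(GSS^T+WHS^T+EH^T,\ W^TWH+W^TGS+G^TE)$; $\lambda_{\min}$ is its smallest eigenvalue. A strict saddle is a point with $\nabla J=0$ and $\lambda_{\min}(\nabla^2J)<0$. The orbit is $\Theta(W,S)=\{(WA,A^{-1}S):A\in\mathrm{GL}_k\}$, where $\mathrm{GL}_k$ is the group of invertible real $k\times k$ matrices. Canonical point with $\mathrm{rank}(W_c)=k$: take a full SVD of $X$, i.e. orthonormal bases $u_1,\dots,u_m$ of $\mathbb{R}^m$ and $v_1,\dots,v_n$ of $\mathbb{R}^n$ with $Xv_i=\sigma_iu_i$, $X^Tu_i=\sigma_iv_i$ for $i\le m$ and $Xv_i=0$ for $i>m$. Choose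 $k$ distinct indices $i_1,\dots,i_k\in\{1,\dots,m\}$ ordered so that $\lambda_j:=\sigma_{i_j}$ satisfies $\lambda_1\ge\dots\ge\lambda_k$; put $\bar U=[u_{i_1},\dots,u_{i_k}]$, $\bar V=[v_{i_1},\dots,v_{i_k}]$, $\Lambda=\mathrm{diag}(\lambda_1,\dots,\lambda_k)$. The canonical point is $(W_c,S_c)=(\bar U,\Lambda\bar V^T)$. *)

theory Defs
  imports "HOL-Analysis.Analysis"
begin

text \<open>
  The norm of \<^typ>\<open>real ^ 'n ^ 'm\<close> is the Frobenius norm, and the library inner product of
  \<^typ>\<open>(real ^ 'k ^ 'm) \<times> (real ^ 'n ^ 'k)\<close> is the trace inner product
  (\<open>inner_matrix_pair\<close> below).
\<close>

definition J :: "real ^ 'n ^ 'm \<Rightarrow> real ^ 'k ^ 'm \<Rightarrow> real ^ 'n ^ 'k \<Rightarrow> real" where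
  "J X W S = (norm (X - W ** S))\<^sup>2 / 2"

text \<open>
  Gradient and Hessian are given by their closed forms; \<open>GDERIV_J\<close> and \<open>has_derivative_grad_J\<close>
  show that they are the derivatives of \<^const>\<open>J\<close>.
\<close>

definition grad_J :: "real ^ 'n ^ 'm \<Rightarrow> real ^ 'k ^ 'm \<Rightarrow> real ^ 'n ^ 'k
    \<Rightarrow> (real ^ 'k ^ 'm) \<times> (real ^ 'n ^ 'k)" where
  "grad_J X W S = (let E = W ** S - X in (E ** transpose S, transpose W ** E))"

definition hess_J :: "real ^ 'n ^ 'm \<Rightarrow> real ^ 'k ^ 'm \<Rightarrow> real ^ 'n ^ 'k
    \<Rightarrow> (real ^ 'k ^ 'm) \<times> (real ^ 'n ^ 'k) \<Rightarrow> (real ^ 'k ^ 'm) \<times> (real ^ 'n ^ 'k)" where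
  "hess_J X W S = (\<lambda>(G, H). let E = W ** S - X in
     (G ** S ** transpose S + W ** H ** transpose S + E ** transpose H,
      transpose W ** W ** H + transpose W ** G ** S + transpose G ** E))"

definition eigenvalues :: "('a::real_vector \<Rightarrow> 'a) \<Rightarrow> real set" where
  "eigenvalues T = {\<mu>. \<exists>x. x \<noteq> 0 \<and> T x = \<mu> *\<^sub>R x}"

text \<open>
  Only meaningful if the set of eigenvalues is finite and nonempty; see
  \<open>eigenvalues_hess_J\<close> below.
\<close>

definition lambda_min :: "('a::real_vector \<Rightarrow> 'a) \<Rightarrow> real" where
  "lambda_min T = Min (eigenvalues T)"

definition strict_saddle :: "real ^ 'n ^ 'm \<Rightarrow> real ^ 'k ^ 'm \<Rightarrow> real ^ 'n ^ 'k \<Rightarrow> bool" where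
  "strict_saddle X W S \<longleftrightarrow> grad_J X W S = 0 \<and> lambda_min (hess_J X W S) < 0"

definition orbit :: "real ^ 'k ^ 'm \<Rightarrow> real ^ 'n ^ 'k
    \<Rightarrow> ((real ^ 'k ^ 'm) \<times> (real ^ 'n ^ 'k)) set" where
  "orbit W S = {(W ** A, matrix_inv A ** S) | A :: real ^ 'k ^ 'k. invertible A}"

text \<open>
  The bases and the singular values are indexed by the natural numbers \<open>1, 2, \<dots>\<close> up to the
  respective dimension, so that \<open>u\<^sub>i\<close> and \<open>v\<^sub>i\<close> share an index; values outside are irrelevant.
\<close>

definition orthonormal_basis :: "(nat \<Rightarrow> 'a::euclidean_space) \<Rightarrow> bool" where
  "orthonormal_basis w \<longleftrightarrow>
     (\<forall>i\<in>{1..DIM('a)}. \<forall>j\<in>{1..DIM('a)}. w i \<bullet> w j = (if i = j then 1 else 0)) \<and>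
     span (w ` {1..DIM('a)}) = UNIV"

definition full_svd :: "real ^ 'n ^ 'm \<Rightarrow> (nat \<Rightarrow> real) \<Rightarrow> (nat \<Rightarrow> real ^ 'm) \<Rightarrow> (nat \<Rightarrow> real ^ 'n)
    \<Rightarrow> bool" where
  "full_svd X \<sigma> u v \<longleftrightarrow>
     orthonormal_basis u \<and> orthonormal_basis v \<and>
     (\<forall>i\<in>{1..CARD('m)}. \<sigma> i \<ge> 0) \<and>
     (\<forall>i\<in>{1..CARD('m)}. \<forall>j\<in>{1..CARD('m)}. i \<le> j \<longrightarrow> \<sigma> j \<le> \<sigma> i) \<and>
     (\<forall>i\<in>{1..CARD('m)}. X *v v i = \<sigma> i *\<^sub>R u i \<and> transpose X *v u i = \<sigma> i *\<^sub>R v i) \<and>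
     (\<forall>i\<in>{CARD('m)<..CARD('n)}. X *v v i = 0)"

definition cols :: "('k \<Rightarrow> real ^ 'm) \<Rightarrow> real ^ 'k ^ 'm" where
  "cols w = (\<chi> a j. w j $ a)"

definition diag :: "('k \<Rightarrow> real) \<Rightarrow> real ^ 'k ^ 'k" where
  "diag d = (\<chi> i j. if i = j then d i else 0)"

text \<open>
  The chosen indices \<open>i\<^sub>1, \<dots>, i\<^sub>k\<close> are given by an injection \<open>\<iota>\<close> from the index type \<^typ>\<open>'k\<close>,
  whose linear order expresses the ordering of the columns.
\<close>

definition canonical_point :: "real ^ 'n ^ 'm \<Rightarrow> real ^ 'k::{finite,linorder} ^ 'm
    \<Rightarrow> real ^ 'n ^ 'k::{finite,linorder} \<Rightarrow> bool" where
  "canonical_point X W S \<longleftrightarrow> (\<exists>\<sigma> u v. \<exists>\<iota> :: 'k \<Rightarrow> nat.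
     full_svd X \<sigma> u v \<and>
     inj \<iota> \<and> range \<iota> \<subseteq> {1..CARD('m)} \<and>
     (\<forall>i j. i \<le> j \<longrightarrow> \<sigma> (\<iota> j) \<le> \<sigma> (\<iota> i)) \<and>
     W = cols (u \<circ> \<iota>) \<and>
     S = diag (\<sigma> \<circ> \<iota>) ** transpose (cols (v \<circ> \<iota>)))"

lemma inner_matrix: "inner A B = trace (transpose A ** B)" for A B :: "real ^ 'n ^ 'm"
  unfolding trace_def matrix_matrix_mult_def transpose_def inner_vec_def
  by (simp, rule sum.swap)

lemma inner_matrix_pair:
  fixes G G' :: "real ^ 'k ^ 'm" and H H' :: "real ^ 'n ^ 'k"
  shows "inner (G, H) (G', H') = trace (transpose G ** G') + trace (transpose H ** H')"
  by (simp add: inner_matrix)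

lemma inner_mult_left: "inner (A ** B) C = inner B (transpose A ** C)"
  for A :: "real ^ 'k ^ 'm" and B :: "real ^ 'n ^ 'k"
  by (simp add: inner_matrix matrix_transpose_mul matrix_mul_assoc)

lemma inner_mult_right: "inner (A ** B) C = inner A (C ** transpose B)"
  for A :: "real ^ 'k ^ 'm" and B :: "real ^ 'n ^ 'k"
  by (metis inner_matrix matrix_mul_assoc matrix_transpose_mul trace_mul_sym)

lemma bounded_bilinear_mult:
  "bounded_bilinear (\<lambda>(A :: real ^ 'k ^ 'm) (B :: real ^ 'n ^ 'k). A ** B)"
  unfolding bilinear_conv_bounded_bilinear[symmetric] bilinear_def
  by (auto intro!: linearI simp: vec_eq_iff matrix_matrix_mult_def sum_distrib_left
      sum.distrib distrib_left distrib_right mult_ac)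

lemma bounded_linear_transpose: "bounded_linear (transpose :: real ^ 'n ^ 'm \<Rightarrow> real ^ 'm ^ 'n)"
  unfolding linear_conv_bounded_linear[symmetric]
  by (auto intro!: linearI simp: transpose_def vec_eq_iff)

lemmas mult_distribs =
  bounded_bilinear.add_left[OF bounded_bilinear_mult]
  bounded_bilinear.add_right[OF bounded_bilinear_mult]

lemmas has_derivative_mult = bounded_bilinear.FDERIV[OF bounded_bilinear_mult]
lemmas has_derivative_transpose = bounded_linear.has_derivative[OF bounded_linear_transpose]

lemma GDERIV_J:
  "GDERIV (\<lambda>(W, S). J X W S) (W, S) :> grad_J X W S"
proof -
  have "((\<lambda>p. inner (X - fst p ** snd p) (X - fst p ** snd p) / 2) has_derivative
      (\<lambda>h. - inner (W ** snd h + fst h ** S) (X - W ** S))) (at (W, S))"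
    by (rule has_derivative_eq_rhs,
        (rule derivative_eq_intros has_derivative_mult refl | simp)+,
        rule ext, simp add: inner_commute inner_diff_right inner_add_right)
  moreover have "- inner (W ** snd h + fst h ** S) (X - W ** S) = inner h (grad_J X W S)" for h
  proof -
    have "- inner (W ** snd h + fst h ** S) (X - W ** S)
        = inner (W ** snd h) (W ** S - X) + inner (fst h ** S) (W ** S - X)"
      by (metis inner_add_left inner_minus_right minus_diff_eq)
    then show ?thesis
      by (simp add: grad_J_def Let_def inner_prod_def
          inner_mult_left[of W "snd h"] inner_mult_right[of "fst h" S])
  qed
  ultimately show ?thesis
    by (simp add: gderiv_def J_def power2_norm_eq_inner case_prod_unfold)
qed

lemma has_derivative_grad_J:
  "((\<lambda>(W, S). grad_J X W S) has_derivative hess_J X W S) (at (W, S))"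
proof -
  have "((\<lambda>p. ((fst p ** snd p - X) ** transpose (snd p), transpose (fst p) ** (fst p ** snd p - X)))
      has_derivative hess_J X W S) (at (W, S))"
    by (rule has_derivative_eq_rhs,
        (rule derivative_eq_intros has_derivative_mult has_derivative_transpose refl | simp)+,
        rule ext,
        simp add: hess_J_def Let_def split_beta matrix_mul_assoc mult_distribs algebra_simps)
  then show ?thesis
    by (simp add: grad_J_def Let_def case_prod_unfold)
qed

lemma linear_hess_J: "linear (hess_J X W S)"
  using has_derivative_grad_J has_derivative_linear by blast

lemma self_adjoint_hess_J: "inner (hess_J X W S p) q = inner p (hess_J X W S q)"
proof -
  obtain G H G' H' where p: "p = (G, H)" and q: "q = (G', H')"
    by (meson surj_pair)
  let ?E = "W ** S - X"
  have "inner (?E ** transpose H) G' = inner H (transpose G' ** ?E)"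
    by (metis inner_commute inner_mult_left inner_mult_right transpose_transpose)
  moreover have "inner (transpose G ** ?E) H' = inner G (?E ** transpose H')"
    by (metis inner_commute inner_mult_left inner_mult_right transpose_transpose)
  moreover have "inner (G ** S ** transpose S) G' = inner G (G' ** S ** transpose S)"
    by (simp add: inner_mult_right)
  moreover have "inner (W ** H ** transpose S) G' = inner H (transpose W ** G' ** S)"
    by (metis inner_mult_left inner_mult_right matrix_mul_assoc transpose_transpose)
  moreover have "inner (transpose W ** W ** H) H' = inner H (transpose W ** W ** H')"
    by (metis inner_mult_left matrix_mul_assoc transpose_transpose)
  moreover have "inner (transpose W ** G ** S) H' = inner G (W ** H' ** transpose S)"
    by (metis inner_mult_left inner_mult_right matrix_mul_assoc transpose_transpose)
  ultimately show ?thesis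
    by (simp add: p q hess_J_def Let_def inner_add_left inner_add_right)
qed

lemma finite_eigenvalues:
  fixes T :: "'a::euclidean_space \<Rightarrow> 'a"
  assumes "\<And>x y. inner (T x) y = inner x (T y)"
  shows "finite (eigenvalues T)"
proof -
  have "\<forall>\<mu>\<in>eigenvalues T. \<exists>x. x \<noteq> 0 \<and> T x = \<mu> *\<^sub>R x"
    by (simp add: eigenvalues_def)
  then obtain e where e: "\<forall>\<mu>\<in>eigenvalues T. e \<mu> \<noteq> 0 \<and> T (e \<mu>) = \<mu> *\<^sub>R e \<mu>"
    by metis
  have ortho: "inner (e \<mu>) (e \<nu>) = 0"
    if "\<mu> \<in> eigenvalues T" "\<nu> \<in> eigenvalues T" "\<mu> \<noteq> \<nu>" for \<mu> \<nu>
    using assms[of "e \<mu>" "e \<nu>"] that e by simp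
  have "inj_on e (eigenvalues T)"
    using ortho e by (metis inj_onI inner_eq_zero_iff)
  moreover have "finite (e ` eigenvalues T)"
    using ortho e
    by (intro independent_imp_finite pairwise_orthogonal_independent)
       (auto simp: pairwise_def orthogonal_def)
  ultimately show ?thesis
    using finite_imageD by blast
qed

lemma eigenvalues_nonempty:
  fixes T :: "'a::euclidean_space \<Rightarrow> 'a"
  assumes T: "linear T" and sa: "\<And>x y. inner (T x) y = inner x (T y)"
  shows "eigenvalues T \<noteq> {}"
proof -
  obtain b :: 'a where b: "b \<in> Basis"
    using nonempty_Basis by blast
  have "continuous_on (sphere 0 1) (\<lambda>x. inner x (T x))"
    using T by (intro continuous_intros linear_continuous_on) (simp add: linear_conv_bounded_linear)
  moreover have "b \<in> sphere 0 1"
    using b by simp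
  ultimately obtain x where x: "x \<in> sphere 0 1"
    and min: "\<And>y. y \<in> sphere 0 1 \<Longrightarrow> inner x (T x) \<le> inner y (T y)"
    using continuous_attains_inf[OF compact_sphere, of "0::'a" 1 "\<lambda>x. inner x (T x)"] by blast
  define \<mu> where "\<mu> = inner x (T x)"
  define r where "r = T x - \<mu> *\<^sub>R x"
  define q where "q y = inner y (T y) - \<mu> * inner y y" for y
  have q_nonneg: "0 \<le> q y" for y
  proof (cases "y = 0")
    case False
    define c where "c = inverse (norm y)"
    have "\<mu> \<le> inner (c *\<^sub>R y) (T (c *\<^sub>R y))"
      unfolding \<mu>_def c_def using False by (intro min) simp
    also have "\<dots> = c\<^sup>2 * inner y (T y)"
      by (simp add: linear_scale[OF T] power2_eq_square)
    finally have "\<mu> * (norm y)\<^sup>2 \<le> (c\<^sup>2 * inner y (T y)) * (norm y)\<^sup>2"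
      by (rule mult_right_mono) simp
    also have "\<dots> = (c * norm y)\<^sup>2 * inner y (T y)"
      by (simp only: power_mult_distrib mult_ac)
    also have "c * norm y = 1"
      using False by (simp add: c_def)
    finally show ?thesis
      by (simp add: q_def power2_norm_eq_inner)
  qed (simp add: q_def)
  have rr: "inner r (T x) - \<mu> * inner r x = inner r r"
    by (metis inner_diff_right inner_scaleR_right r_def)
  have "inner x x = 1"
    using x by (simp add: norm_eq_1)
  then have "q x = 0"
    by (simp add: q_def \<mu>_def)
  have "inner x (T r) = inner r (T x)"
    by (metis inner_commute sa)
  then have "q (x + t *\<^sub>R r) = q x + 2 * t * (inner r (T x) - \<mu> * inner r x) + t\<^sup>2 * q r" for t
    unfolding q_def
    by (simp add: linear_add[OF T] linear_scale[OF T] inner_add_left inner_add_right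
        inner_commute[of x r] power2_eq_square algebra_simps)
  then have q_line: "q (x + t *\<^sub>R r) = 2 * t * inner r r + t\<^sup>2 * q r" for t
    using \<open>q x = 0\<close> rr by simp
  have "inner r r \<le> 0"
  proof (rule ccontr)
    assume "\<not> inner r r \<le> 0"
    then have pos: "inner r r > 0"
      by (simp only: not_le)
    define t where "t = - inner r r / (1 + q r)"
    have "1 + q r > 0"
      using q_nonneg[of r] by simp
    then have "t < 0" and "t * (1 + q r) = - inner r r"
      using pos by (auto simp: t_def divide_neg_pos)
    then have "t * q r = - inner r r - t"
      by (simp add: algebra_simps)
    moreover have "q (x + t *\<^sub>R r) = t * (2 * inner r r + t * q r)"
      unfolding q_line by (simp add: power2_eq_square algebra_simps)
    ultimately have "q (x + t *\<^sub>R r) = t * (inner r r - t)"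
      by simp
    also have "\<dots> < 0"
      using \<open>t < 0\<close> pos by (intro mult_neg_pos; linarith)
    finally show False
      using q_nonneg by (meson not_less)
  qed
  then have "r = 0"
    by (metis inner_eq_zero_iff inner_ge_zero order_antisym)
  then have "T x = \<mu> *\<^sub>R x"
    by (simp add: r_def)
  moreover have "x \<noteq> 0"
    using x by auto
  ultimately show ?thesis
    by (auto simp: eigenvalues_def)
qed

lemma eigenvalues_hess_J:
  "finite (eigenvalues (hess_J X W S))"
  "eigenvalues (hess_J X W S) \<noteq> {}"
  by (intro finite_eigenvalues eigenvalues_nonempty linear_hess_J self_adjoint_hess_J)+

end

theory Submission
  imports Defs
begin

text \<open>
  Move along the orbit by the scalar matrices \<open>A = t I\<close> with \<open>t\<close> tending to infinity; the residual
  \<open>E = W\<^sub>c S\<^sub>c - X\<close> does not change. Let \<open>W = t U\<close> and \<open>S = S\<^sub>c / t\<close>, where \<open>U = W\<^sub>c\<close> has orthonormal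
  columns. The Hessian form at \<open>(G, H)\<close> is \<open>|M|\<^sup>2 + 2 \<langle>E, G H\<rangle>\<close> with \<open>M = G S + W H\<close>. For
  \<open>R = U\<^sup>T M = U\<^sup>T G S\<^sub>c / t + t H\<close>, criticality \<open>E S\<^sub>c\<^sup>T = 0\<close> gives \<open>t \<langle>E, G H\<rangle> = \<langle>E, G R\<rangle>\<close>, and
  \<open>|R| \<le> |M|\<close>. Completing the square, the form is at least \<open>-O(1/t\<^sup>2) |G|\<^sup>2\<close>, so
  the smallest eigenvalue is at least \<open>-O(1/t\<^sup>2)\<close>.
\<close>

text \<open>Moving factors across the trace inner product turns both residual terms into the same
  pairing of \<open>W ** S - X\<close> with \<open>G ** H\<close>, whence the factor 2. The other
  four terms are the expansion of the square.\<close>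

lemma inner_hess_J:
  "inner (hess_J X W S (G, H)) (G, H)
    = (norm (G ** S + W ** H))\<^sup>2 + 2 * inner (W ** S - X) (G ** H)"
proof -
  let ?E = "W ** S - X"
  have EG: "inner (?E ** transpose H) G = inner ?E (G ** H)"
    by (simp add: inner_mult_right)
  have EH: "inner (transpose G ** ?E) H = inner ?E (G ** H)"
    by (simp add: inner_mult_left)
  have "inner (G ** S ** transpose S) G = inner (G ** S) (G ** S)"
    and "inner (W ** H ** transpose S) G = inner (W ** H) (G ** S)"
    by (simp_all add: inner_mult_right[of _ "transpose S"])
  moreover have "inner (transpose W ** W ** H) H = inner (W ** H) (W ** H)"
    and "inner (transpose W ** G ** S) H = inner (G ** S) (W ** H)"
    by (simp_all add: inner_mult_left[of "transpose W"] flip: matrix_mul_assoc)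
  ultimately show ?thesis
    using EG EH
    by (simp add: hess_J_def Let_def power2_norm_eq_inner inner_add_left inner_add_right
        inner_commute)
qed

text \<open>\<open>U ** transpose U\<close> is the orthogonal projection onto the column space of
  \<open>U\<close>, and \<open>U\<close> preserves norms. So this is Pythagoras for
  \<open>M = U ** ?R + (M - U ** ?R)\<close>.\<close>

lemma norm_transpose_mult_le:
  fixes U :: "real ^ 'k ^ 'm" and M :: "real ^ 'n ^ 'm"
  assumes U: "transpose U ** U = mat 1"
  shows "norm (transpose U ** M) \<le> norm M"
proof -
  let ?R = "transpose U ** M"
  have "inner (U ** ?R) (U ** ?R) = inner ?R ?R"
    by (metis U inner_mult_left matrix_mul_assoc matrix_mul_lid)
  moreover have "inner M (U ** ?R) = inner ?R ?R"
    by (simp add: inner_mult_left[of U] inner_commute[of M])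
  ultimately have "inner (M - U ** ?R) (M - U ** ?R) = inner M M - inner ?R ?R"
    by (simp add: inner_diff_left inner_diff_right inner_commute)
  then have "inner ?R ?R \<le> inner M M"
    by (metis diff_ge_0_iff_ge inner_ge_zero)
  then show ?thesis
    by (simp add: norm_le)
qed

lemma inner_hess_J_scaled_ge:
  fixes U :: "real ^ 'k ^ 'm" and S :: "real ^ 'n ^ 'k" and K :: real
  assumes U: "transpose U ** U = mat 1"
    and crit: "(U ** S - X) ** transpose S = 0"
    and t: "t > 0"
    and K: "\<And>(A :: real ^ 'k ^ 'm) (B :: real ^ 'n ^ 'k). norm (A ** B) \<le> norm A * norm B * K"
  shows "inner (hess_J X (t *\<^sub>R U) ((1 / t) *\<^sub>R S) (G, H)) (G, H)
    \<ge> - (K * norm (U ** S - X) / t)\<^sup>2 * (norm G)\<^sup>2"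
proof -
  define E where "E = U ** S - X"
  define M where "M = G ** ((1 / t) *\<^sub>R S) + (t *\<^sub>R U) ** H"
  define R where "R = transpose U ** M"
  note scale = bounded_bilinear.scaleR_left[OF bounded_bilinear_mult]
    bounded_bilinear.scaleR_right[OF bounded_bilinear_mult]
  have E: "(t *\<^sub>R U) ** ((1 / t) *\<^sub>R S) - X = E"
    using t by (simp add: E_def scale)
  have "R = (1 / t) *\<^sub>R (transpose U ** G ** S) + t *\<^sub>R H"
    using U by (simp add: R_def M_def scale mult_distribs matrix_mul_assoc)
  then have "G ** R = (1 / t) *\<^sub>R (G ** (transpose U ** G) ** S) + t *\<^sub>R (G ** H)"
    by (simp add: scale mult_distribs matrix_mul_assoc)
  \<comment> \<open>Moving \<open>S\<close> across the inner product produces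
    \<open>E ** transpose S\<close>, which vanishes by criticality. Hence, paired with
    \<open>E\<close>, the product \<open>G ** H\<close> may be replaced by \<open>G ** R\<close>
    divided by \<open>t\<close>; this is where the factor 1/t comes from.\<close>
  moreover have "inner E (G ** (transpose U ** G) ** S) = 0"
    using crit by (simp add: E_def inner_mult_right[of _ S] inner_commute[of "U ** S - X"])
  ultimately have "inner E (G ** R) = t * inner E (G ** H)"
    by (simp add: inner_add_right)
  then have EGH: "inner E (G ** H) = inner E (G ** R) / t"
    using t by simp
  have "\<bar>inner E (G ** R)\<bar> \<le> norm E * norm (G ** R)"
    by (rule Cauchy_Schwarz_ineq2)
  also have "\<dots> \<le> norm E * (norm G * norm R * K)"
    by (intro mult_left_mono K) simp
  finally have "- inner E (G ** R) / t \<le> norm E * (norm G * norm R * K) / t"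
    using t by (intro divide_right_mono) auto
  then have "inner E (G ** H) \<ge> - (K * norm E / t * norm G * norm R)"
    by (simp add: EGH mult_ac)
  moreover have "(norm R)\<^sup>2 \<le> (norm M)\<^sup>2"
    unfolding R_def by (intro power_mono norm_transpose_mult_le U) simp
  \<comment> \<open>With \<open>r = norm R\<close> and \<open>a = K * norm E / t * norm G\<close>
    this gives \<open>r\<^sup>2 - 2 * a * r \<ge> - a\<^sup>2\<close>, a bound free of
    \<open>R\<close> and therefore of \<open>H\<close>.\<close>
  moreover have "(norm R - K * norm E / t * norm G)\<^sup>2 \<ge> 0"
    by simp
  moreover have "(norm R - K * norm E / t * norm G)\<^sup>2
      = (norm R)\<^sup>2 + (K * norm E / t * norm G)\<^sup>2 - 2 * (K * norm E / t * norm G * norm R)"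
    by (simp add: power2_diff mult_ac)
  ultimately have "(norm M)\<^sup>2 + 2 * inner E (G ** H) \<ge> - (K * norm E / t * norm G)\<^sup>2"
    by linarith
  then show ?thesis
    unfolding inner_hess_J E M_def[symmetric]
    by (simp only: E_def[symmetric] power_mult_distrib mult_minus_left)
qed

text \<open>Evaluate the quadratic form at an eigenvector. A bound in \<open>G\<close> alone
  suffices because \<open>norm G\<close> is at most the norm of the pair and \<open>c\<close> is
  nonnegative.\<close>

lemma lambda_min_hess_J_ge:
  assumes bound: "\<And>G H. inner (hess_J X W S (G, H)) (G, H) \<ge> - c * (norm G)\<^sup>2"
    and "c \<ge> 0"
  shows "lambda_min (hess_J X W S) \<ge> - c"
proof -
  have "- c \<le> \<mu>" if \<mu>: "\<mu> \<in> eigenvalues (hess_J X W S)" for \<mu>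
  proof -
    obtain G H where nz: "(G, H) \<noteq> 0" and eig: "hess_J X W S (G, H) = \<mu> *\<^sub>R (G, H)"
      using \<mu> by (auto simp: eigenvalues_def)
    have "inner (G, H) (G, H) = (norm G)\<^sup>2 + (norm H)\<^sup>2"
      by (simp add: power2_norm_eq_inner)
    then have "c * (norm G)\<^sup>2 \<le> c * inner (G, H) (G, H)"
      using \<open>c \<ge> 0\<close> by (intro mult_left_mono) auto
    then have "- c * inner (G, H) (G, H) \<le> \<mu> * inner (G, H) (G, H)"
      using bound[of G H] unfolding eig inner_scaleR_left by linarith
    moreover have "inner (G, H) (G, H) > 0"
      using nz inner_gt_zero_iff by blast
    ultimately show ?thesis
      using mult_le_cancel_right_pos by blast
  qed
  then show ?thesis
    by (simp add: lambda_min_def eigenvalues_hess_J)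
qed

lemma scaled_in_orbit:
  assumes "t \<noteq> 0"
  shows "(t *\<^sub>R W, (1 / t) *\<^sub>R S) \<in> orbit W S"
proof -
  let ?A = "t *\<^sub>R mat 1 :: real ^ 'k ^ 'k" and ?B = "(1 / t) *\<^sub>R mat 1 :: real ^ 'k ^ 'k"
  note scale = bounded_bilinear.scaleR_left[OF bounded_bilinear_mult]
    bounded_bilinear.scaleR_right[OF bounded_bilinear_mult]
  have "?A ** ?B = mat 1" "?B ** ?A = mat 1"
    using assms by (simp_all add: scale)
  \<comment> \<open>\<open>matrix_inv\<close> is a Hilbert choice, so its value is identified
    through uniqueness of two-sided inverses.\<close>
  then have "invertible ?A" "matrix_inv ?A = ?B"
    unfolding invertible_def matrix_inv_def
    by (blast, intro some_equality) (auto, metis matrix_mul_assoc matrix_mul_lid matrix_mul_rid)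
  moreover have "t *\<^sub>R W = W ** ?A" "(1 / t) *\<^sub>R S = ?B ** S"
    by (simp_all add: scale)
  ultimately show ?thesis
    unfolding orbit_def by (metis (mono_tags, lifting) mem_Collect_eq)
qed

text \<open>Injectivity of \<open>\<iota>\<close> makes the columns distinct members of an
  orthonormal basis. This supplies the assumption on \<open>U\<close> in the Hessian bound.\<close>

lemma canonical_point_orthonormal_cols:
  fixes W :: "real ^ 'k::{finite,linorder} ^ 'm"
  assumes "canonical_point X W S"
  shows "transpose W ** W = mat 1"
proof -
  obtain u and \<iota> :: "'k \<Rightarrow> nat" where u: "orthonormal_basis u"
    and \<iota>: "inj \<iota>" "range \<iota> \<subseteq> {1..CARD('m)}" and W: "W = cols (u \<circ> \<iota>)"
    using assms unfolding canonical_point_def full_svd_def by blast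
  have "inner (u (\<iota> i)) (u (\<iota> j)) = (if i = j then 1 else 0)" for i j
  proof -
    have "\<iota> i \<in> {1..DIM(real ^ 'm)}" "\<iota> j \<in> {1..DIM(real ^ 'm)}"
      using \<iota>(2) by (simp_all add: image_subset_iff)
    then show ?thesis
      using u \<iota>(1) unfolding orthonormal_basis_def by (simp add: inj_eq)
  qed
  then show ?thesis
    by (simp add: W vec_eq_iff cols_def matrix_matrix_mult_def transpose_def mat_def
        inner_vec_def)
qed

theorem theorem4p1:
  fixes X :: "real ^ 'n ^ 'm"
    and W\<^sub>c :: "real ^ 'k::{finite,linorder} ^ 'm"
    and S\<^sub>c :: "real ^ 'n ^ 'k::{finite,linorder}"
  assumes "CARD('m) < CARD('n)" and "CARD('k) < CARD('m)"
    and "canonical_point X W\<^sub>c S\<^sub>c"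
    and "rank W\<^sub>c = CARD('k)"
    and "strict_saddle X W\<^sub>c S\<^sub>c"
  shows "\<not> (\<exists>\<gamma><0. \<forall>(W, S)\<in>orbit W\<^sub>c S\<^sub>c. lambda_min (hess_J X W S) \<le> \<gamma>)"
proof
  assume "\<exists>\<gamma><0. \<forall>(W, S)\<in>orbit W\<^sub>c S\<^sub>c. lambda_min (hess_J X W S) \<le> \<gamma>"
  then obtain \<gamma> where \<gamma>: "\<gamma> < 0"
    and le: "\<And>W S. (W, S) \<in> orbit W\<^sub>c S\<^sub>c \<Longrightarrow> lambda_min (hess_J X W S) \<le> \<gamma>"
    by blast
  obtain K where K: "\<And>(A :: real ^ 'k::{finite,linorder} ^ 'm)
      (B :: real ^ 'n ^ 'k::{finite,linorder}).
      norm (A ** B) \<le> norm A * norm B * K"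
    using bounded_bilinear.bounded[OF bounded_bilinear_mult] by blast
  define e where "e = K * norm (W\<^sub>c ** S\<^sub>c - X)"
  \<comment> \<open>Chosen so that \<open>(e / t)\<^sup>2 < - \<gamma>\<close>. The summand 1 makes
    this strict and keeps \<open>t\<close> positive when \<open>e = 0\<close>; the absolute value is
    there because \<open>K\<close> comes without a sign.\<close>
  define t where "t = 1 + \<bar>e\<bar> / sqrt (- \<gamma>)"
  have t: "t > 0"
    unfolding t_def using \<gamma> by (intro add_pos_nonneg) auto
  have "\<bar>e\<bar> < t * sqrt (- \<gamma>)"
    using \<gamma> by (simp add: t_def field_simps)
  then have "\<bar>e / t\<bar> < sqrt (- \<gamma>)"
    using t by (simp add: field_simps)
  then have "(e / t)\<^sup>2 < - \<gamma>"
    by (metis abs_ge_zero power2_abs real_less_rsqrt real_sqrt_abs real_sqrt_less_iff)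
  moreover have "(W\<^sub>c ** S\<^sub>c - X) ** transpose S\<^sub>c = 0"
    using assms(5) by (simp add: strict_saddle_def grad_J_def Let_def prod_eq_iff)
  then have "lambda_min (hess_J X (t *\<^sub>R W\<^sub>c) ((1 / t) *\<^sub>R S\<^sub>c)) \<ge> - (e / t)\<^sup>2"
    unfolding e_def using canonical_point_orthonormal_cols[OF assms(3)] t K
    by (intro lambda_min_hess_J_ge inner_hess_J_scaled_ge) auto
  moreover have "lambda_min (hess_J X (t *\<^sub>R W\<^sub>c) ((1 / t) *\<^sub>R S\<^sub>c)) \<le> \<gamma>"
    using t by (intro le scaled_in_orbit) simp
  ultimately show False
    by simp
qed

end
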